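(* Let $n\ge 4$ be even and let $\mathbb{D}=(\{1,\ldots,n\},\mathcal{B})$ be an $\frac{n-2}{2}$-$(n,\frac n2,1)$ design. Let $w\in \mathrm{GF}(2)^n$ be such that its support has cardinality $n/2$ and is not a block of $\mathbb{D}$. Then $$\hat f_{\mathbb{D}}(w)=-\frac{2\left(a-P_{n/2}(n/2)\right)}{n},$$ where $$a=2^{n/2}-\frac{2\sum_{h=1}^{n/2}\binom{n/2}{h}\sum_{\ell=0}^{h-1}(-1)^\ell\binom{(n+2)/2}{\ell+1}}{n+2}.$$
   Context: A $t$-$(n,k,\lambda)$ design, $1\le t\le k\le n$, is a pair $(\mathcal{P},\mathcal{B})$ where $\mathcal{P}=\{1,\ldots,n\}$ and $\mathcal{B}$ is a set of $k$-subsets (blocks) of $\mathcal{P}$ such that every $t$-subset of $\mathcal{P}$ is contained in exactly $\lambda$ blocks. The support of $x\in \mathrm{GF}(2)^n$ is $\{i: x_i=1\}$. The characteristic function $f_{\mathbb{D}}:\mathrm{GF}(2)^n\to\{0,1\}\subset\mathbb{R}$ has $f_{\mathbb{D}}(x)=1$ if and only if the support of $x$ is a block. The Walsh transform is $\hat f(w)=\sum_{x\in \mathrm{GF}(2)^n}f(x)(-1)^{w\cdot x}$, where $w\cdot x=\sum_i w_ix_i$. The Krawtchouk polynomial is $P_k(x)=\sum_{j=0}^{k}(-1)^j\binom{x}{j}\binom{n-x}{k-j}$. *)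

theory Defs
  imports Complex_Main "HOL-Library.FuncSet" "HOL-Library.Z2"
begin

text \<open>
  \<open>t\<close>-designs with point set \<open>{1..n}\<close>. A design is a pair of a point set and a set of blocks;
  being a set, the latter has no repeated blocks.
\<close>

type_synonym block_design = "nat set \<times> nat set set"

definition t_design :: "nat \<Rightarrow> nat \<Rightarrow> nat \<Rightarrow> nat \<Rightarrow> block_design \<Rightarrow> bool" where
  "t_design t n k l D \<longleftrightarrow>
     1 \<le> t \<and> t \<le> k \<and> k \<le> n \<and>
     fst D = {1..n} \<and>
     (\<forall>b\<in>snd D. b \<subseteq> {1..n} \<and> card b = k) \<and>
     (\<forall>T. T \<subseteq> {1..n} \<and> card T = t \<longrightarrow> card {b \<in> snd D. T \<subseteq> b} = l)"

text \<open>
  Vectors in \<open>GF(2)\<^sup>n\<close> are functions on \<open>{1..n}\<close> with values in the field \<^typ>\<open>bit\<close>, made unique by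
  the convention of \<open>PiE\<close> that they are \<^term>\<open>undefined\<close> elsewhere.
\<close>

definition gf2_vecs :: "nat \<Rightarrow> (nat \<Rightarrow> bit) set" where
  "gf2_vecs n = ({1..n} \<rightarrow>\<^sub>E UNIV)"

definition vec_support :: "nat \<Rightarrow> (nat \<Rightarrow> bit) \<Rightarrow> nat set" where
  "vec_support n x = {i \<in> {1..n}. x i = 1}"

definition dot_prod :: "nat \<Rightarrow> (nat \<Rightarrow> bit) \<Rightarrow> (nat \<Rightarrow> bit) \<Rightarrow> bit" where
  "dot_prod n w x = (\<Sum>i=1..n. w i * x i)"

definition design_char :: "nat \<Rightarrow> block_design \<Rightarrow> (nat \<Rightarrow> bit) \<Rightarrow> real" where
  "design_char n D x = (if vec_support n x \<in> snd D then 1 else 0)"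

definition walsh :: "nat \<Rightarrow> ((nat \<Rightarrow> bit) \<Rightarrow> real) \<Rightarrow> (nat \<Rightarrow> bit) \<Rightarrow> real" where
  "walsh n f w = (\<Sum>x\<in>gf2_vecs n. f x * (-1) ^ (of_bit (dot_prod n w x) :: nat))"

text \<open>
  The Krawtchouk polynomial \<open>P\<^sub>k\<close> for length \<open>n\<close>; generalised binomial coefficients make it
  a polynomial in the real argument \<open>x\<close>.
\<close>

definition krawtchouk :: "nat \<Rightarrow> nat \<Rightarrow> real \<Rightarrow> real" where
  "krawtchouk n k x = (\<Sum>j=0..k. (-1) ^ j * (x gchoose j) * ((real n - x) gchoose (k - j)))"

end

theory Submission
  imports Defs
begin

text \<open>
  Write \<open>n = 2m\<close> and \<open>W\<close> for the support of \<open>w\<close>. The Walsh value is the signed block count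
  \<open>S = \<Sum>B. (-1)^|W \<inter> B|\<close>, and the same signed count over all \<open>m\<close>-subsets is
  the Krawtchouk value \<open>P = P\<^sub>m(m)\<close> (\<open>walsh_design_char\<close>, \<open>signed_sum_subsets_krawtchouk\<close>).
  The two are comparable because a Steiner system looks uniform from below: for \<open>|T| < m\<close>,
  exactly one in \<open>m + 1\<close> of the \<open>m\<close>-subsets that contain \<open>T\<close> is a block.
  The sign expands as \<open>(-1)^|W \<inter> B| = \<Sum>T \<subseteq> W \<inter> B. (-2)^|T|\<close>, so in
  \<open>(m + 1) S - P\<close> all sets \<open>T\<close> cancel except \<open>T = W\<close>, which lies in no block and in a single
  \<open>m\<close>-subset. This gives \<open>(m + 1) S = P - (-2)^m\<close> (\<open>steiner_signed_sum\<close>).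

  The sign of \<open>(-2)^m\<close> is settled by an existence condition: counting the blocks through an
  \<open>(m - 2)\<close>-set shows that \<open>m\<close> is even (\<open>even_block_size\<close>). Finally the inner sum in \<open>a\<close>
  telescopes to \<open>1 - (-1)^h (m choose h)\<close>, whence the double sum is \<open>2^m - P\<close>
  and \<open>a = (m 2^m + P) / (m + 1)\<close>; so \<open>- (a - P) / m = (P - 2^m) / (m + 1) = S\<close>.
\<close>

section \<open>Signed block counts in Steiner systems\<close>

lemma card_intermediate_subsets:
  assumes "finite B" "T \<subseteq> B" "card T \<le> t"
  shows "card {U. T \<subseteq> U \<and> U \<subseteq> B \<and> card U = t} = (card B - card T) choose (t - card T)"
proof -
  have fT: "finite T" using assms finite_subset by blast
  have "bij_betw (\<lambda>U. U - T) {U. T \<subseteq> U \<and> U \<subseteq> B \<and> card U = t}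
          {X. X \<subseteq> B - T \<and> card X = t - card T}"
  proof (rule bij_betw_byWitness[where f' = "\<lambda>X. X \<union> T"])
    show "(\<lambda>U. U - T) ` {U. T \<subseteq> U \<and> U \<subseteq> B \<and> card U = t}
            \<subseteq> {X. X \<subseteq> B - T \<and> card X = t - card T}"
      using fT by (auto simp: card_Diff_subset)
    show "(\<lambda>X. X \<union> T) ` {X. X \<subseteq> B - T \<and> card X = t - card T}
            \<subseteq> {U. T \<subseteq> U \<and> U \<subseteq> B \<and> card U = t}"
    proof clarsimp
      fix X assume X: "X \<subseteq> B - T" "card X = t - card T"
      then have "finite X" "X \<inter> T = {}" using assms(1) finite_subset by blast+
      then show "X \<subseteq> B \<and> T \<subseteq> B \<and> card (X \<union> T) = t"
        using X fT assms by (auto simp: card_Un_disjoint)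
    qed
  qed auto
  then have "card {U. T \<subseteq> U \<and> U \<subseteq> B \<and> card U = t} = card {X. X \<subseteq> B - T \<and> card X = t - card T}"
    by (rule bij_betw_same_card)
  also have "\<dots> = card (B - T) choose (t - card T)"
    using assms(1) by (simp add: n_subsets)
  finally show ?thesis
    using fT assms(2) by (simp add: card_Diff_subset)
qed

text \<open>
  Both sides count the pairs \<open>(U, B)\<close> with \<open>T \<subseteq> U \<subseteq> B\<close>, \<open>|U| = t\<close> and \<open>B \<in> F\<close>. Regularity is asked
  of an arbitrary family, so that the count can be applied both to the blocks of a design and
  to the family of all \<open>k\<close>-subsets.
\<close>

lemma blocks_containing_subset:
  assumes V: "finite V" "T \<subseteq> V" "card T \<le> t"
    and F: "\<And>B. B \<in> F \<Longrightarrow> B \<subseteq> V \<and> card B = k"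
    and reg: "\<And>U. T \<subseteq> U \<Longrightarrow> U \<subseteq> V \<Longrightarrow> card U = t \<Longrightarrow> card {B \<in> F. U \<subseteq> B} = l"
  shows "card {B \<in> F. T \<subseteq> B} * ((k - card T) choose (t - card T))
           = l * ((card V - card T) choose (t - card T))"
proof -
  let ?FT = "{B \<in> F. T \<subseteq> B}" and ?UT = "{U. T \<subseteq> U \<and> U \<subseteq> V \<and> card U = t}"
  have "finite F" using F V(1) by (intro finite_subset[of F "Pow V"]) auto
  then have fin: "finite ?FT" "finite ?UT" using V(1) by auto
  have "card {U \<in> ?UT. U \<subseteq> B} = (k - card T) choose (t - card T)" if "B \<in> ?FT" for B
  proof -
    have "{U \<in> ?UT. U \<subseteq> B} = {U. T \<subseteq> U \<and> U \<subseteq> B \<and> card U = t}" using that F by blast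
    then show ?thesis
      using that F[of B] V card_intermediate_subsets[of B T t] finite_subset[of B V] by auto
  qed
  then have "(\<Sum>B\<in>?FT. card {U \<in> ?UT. U \<subseteq> B}) = card ?FT * ((k - card T) choose (t - card T))"
    by simp
  moreover have "card {B \<in> ?FT. U \<subseteq> B} = l" if "U \<in> ?UT" for U
  proof -
    have "{B \<in> ?FT. U \<subseteq> B} = {B \<in> F. U \<subseteq> B}" using that by blast
    then show ?thesis using that reg by simp
  qed
  then have "(\<Sum>U\<in>?UT. card {B \<in> ?FT. U \<subseteq> B}) = l * card ?UT" by simp
  moreover have "(\<Sum>B\<in>?FT. card {U \<in> ?UT. U \<subseteq> B}) = (\<Sum>U\<in>?UT. card {B \<in> ?FT. U \<subseteq> B})"
    using sum.swap_restrict[OF fin, of "\<lambda>_ _. 1::nat" "\<lambda>B U. U \<subseteq> B"] by simp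
  ultimately show ?thesis
    using card_intermediate_subsets[OF V] by simp
qed

text \<open>
  This is the expansion of \<open>(1 + (-2))^|A|\<close> as a product over the elements of \<open>A\<close>. It turns a sign
  that depends on \<open>|W \<inter> B|\<close> into a combination of indicators of \<open>T \<subseteq> B\<close>, which a design controls.
\<close>

lemma minus_one_power_card:
  fixes A :: "'a set"
  assumes "finite A"
  shows "(\<Sum>T\<in>Pow A. (-2) ^ card T) = ((-1) ^ card A :: real)"
  using assms
proof (induction A rule: finite_induct)
  case (insert x A)
  have inj: "inj_on (insert x) (Pow A)" using insert.hyps by (auto simp: inj_on_def)
  have card_ins: "card (insert x T) = Suc (card T)" if "T \<in> Pow A" for T
    using that insert.hyps finite_subset[of T A] by (subst card_insert_disjoint) auto
  have "(\<Sum>T\<in>Pow (insert x A). (-2) ^ card T :: real)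
      = (\<Sum>T\<in>Pow A. (-2) ^ card T) + (\<Sum>T\<in>insert x ` Pow A. (-2) ^ card T)"
    unfolding Pow_insert using insert.hyps by (intro sum.union_disjoint) auto
  also have "(\<Sum>T\<in>insert x ` Pow A. (-2) ^ card T :: real) = (\<Sum>T\<in>Pow A. -2 * (-2) ^ card T)"
    by (simp add: sum.reindex[OF inj] card_ins del: Pow_iff)
  finally show ?case
    using insert by (simp add: sum_distrib_left[symmetric] sum_negf)
qed simp

lemma signed_sum_expand:
  fixes g :: "'a set \<Rightarrow> real"
  assumes "finite F" "finite W"
  shows "(\<Sum>B\<in>F. g B * (-1) ^ card (W \<inter> B)) = (\<Sum>T\<in>Pow W. (-2) ^ card T * (\<Sum>B\<in>{B \<in> F. T \<subseteq> B}. g B))"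
proof -
  have "g B * (-1) ^ card (W \<inter> B) = (\<Sum>T\<in>{T \<in> Pow W. T \<subseteq> B}. (-2) ^ card T * g B)" for B
  proof -
    have "{T \<in> Pow W. T \<subseteq> B} = Pow (W \<inter> B)" by blast
    then have "(\<Sum>T\<in>{T \<in> Pow W. T \<subseteq> B}. (-2) ^ card T * g B) = (-1) ^ card (W \<inter> B) * g B"
      using minus_one_power_card[of "W \<inter> B"] assms(2)
      by (simp only: sum_distrib_right[symmetric] finite_Int simp_thms)
    then show ?thesis by simp
  qed
  then have "(\<Sum>B\<in>F. g B * (-1) ^ card (W \<inter> B))
      = (\<Sum>B\<in>F. \<Sum>T\<in>{T \<in> Pow W. T \<subseteq> B}. (-2) ^ card T * g B)" by simp
  also have "\<dots> = (\<Sum>T\<in>Pow W. \<Sum>B\<in>{B \<in> F. T \<subseteq> B}. (-2) ^ card T * g B)"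
    using assms by (intro sum.swap_restrict) auto
  finally show ?thesis by (simp add: sum_distrib_left)
qed

text \<open>
  The weight \<open>g = c 1\<^sub>B\<^sub>l - 1\<close> on \<open>k\<close>-subsets, with \<open>c = |V| - k + 1\<close> the number of \<open>k\<close>-subsets
  through a given \<open>(k - 1)\<close>-set, sums to zero over the \<open>k\<close>-subsets containing \<open>T\<close> whenever
  \<open>|T| < k\<close>. Expanding its signed sum over the subsets \<open>T\<close> of \<open>W\<close> therefore leaves only \<open>T = W\<close>,
  with contribution \<open>(-2)^k g(W) = - (-2)^k\<close>.
\<close>

lemma steiner_signed_sum:
  fixes V W :: "'a set"
  assumes V: "finite V" "W \<subseteq> V" "card W = k" "1 \<le> k"
    and Bl: "\<And>B. B \<in> Bl \<Longrightarrow> B \<subseteq> V \<and> card B = k"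
    and steiner: "\<And>U. U \<subseteq> V \<Longrightarrow> card U = k - 1 \<Longrightarrow> card {B \<in> Bl. U \<subseteq> B} = 1"
    and W: "W \<notin> Bl"
  shows "(real (card V) - real k + 1) * (\<Sum>B\<in>Bl. (-1) ^ card (W \<inter> B))
           = (\<Sum>B\<in>{B. B \<subseteq> V \<and> card B = k}. (-1) ^ card (W \<inter> B)) - (-2) ^ k"
proof -
  let ?F = "{B. B \<subseteq> V \<and> card B = k}"
  define c where "c = card V - k + 1"
  have "k \<le> card V" using V card_mono by blast
  then have c: "real c = real (card V) - real k + 1" by (simp add: c_def of_nat_diff)
  have fin: "finite ?F" "finite W" using V finite_subset by auto
  have sub: "Bl \<subseteq> ?F" using Bl by blast
  define g where "g B = (if B \<in> Bl then real c else 0) - 1" for B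
  have cover: "card {B \<in> ?F. U \<subseteq> B} = c" if "U \<subseteq> V" "card U = k - 1" for U
  proof -
    have "{B \<in> ?F. U \<subseteq> B} = {B. U \<subseteq> B \<and> B \<subseteq> V \<and> card B = k}" by blast
    then show ?thesis
      using card_intermediate_subsets[of V U k] that V \<open>k \<le> card V\<close> by (simp add: c_def)
  qed
  have sum_g: "(\<Sum>B\<in>{B \<in> ?F. T \<subseteq> B}. g B)
      = real c * card {B \<in> Bl. T \<subseteq> B} - card {B \<in> ?F. T \<subseteq> B}" for T
  proof -
    have "{B \<in> ?F. T \<subseteq> B} \<inter> Bl = {B \<in> Bl. T \<subseteq> B}" using sub by blast
    moreover have "finite {B \<in> ?F. T \<subseteq> B}" using fin(1) by (rule rev_finite_subset) blast
    ultimately show ?thesis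
      by (simp add: g_def sum_subtractf sum.inter_restrict[symmetric])
  qed
  have zero: "(\<Sum>B\<in>{B \<in> ?F. T \<subseteq> B}. g B) = 0" if T: "T \<in> Pow W - {W}" for T
  proof -
    have TV: "T \<subseteq> V" and "card T < k"
      using T V fin psubset_card_mono[of W T] by auto
    then have ct: "card T \<le> k - 1" and pos: "0 < (k - card T) choose (k - 1 - card T)"
      by (auto simp: zero_less_binomial_iff)
    have "card {B \<in> Bl. T \<subseteq> B} * ((k - card T) choose (k - 1 - card T))
        = 1 * ((card V - card T) choose (k - 1 - card T))"
      by (rule blocks_containing_subset[OF V(1) TV ct Bl steiner]) auto
    moreover have "card {B \<in> ?F. T \<subseteq> B} * ((k - card T) choose (k - 1 - card T))
        = c * ((card V - card T) choose (k - 1 - card T))"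
      by (rule blocks_containing_subset[OF V(1) TV ct _ cover]) auto
    ultimately have "card {B \<in> ?F. T \<subseteq> B} * ((k - card T) choose (k - 1 - card T))
        = (c * card {B \<in> Bl. T \<subseteq> B}) * ((k - card T) choose (k - 1 - card T))"
      by simp
    with pos have "card {B \<in> ?F. T \<subseteq> B} = c * card {B \<in> Bl. T \<subseteq> B}" by simp
    then show ?thesis unfolding sum_g by simp
  qed
  have onlyW: "{B \<in> ?F. W \<subseteq> B} = {W}"
    using V card_subset_eq[of _ W] finite_subset[of _ V] by blast
  have "(\<Sum>B\<in>?F. g B * (-1) ^ card (W \<inter> B))
      = (\<Sum>T\<in>Pow W. (-2) ^ card T * (\<Sum>B\<in>{B \<in> ?F. T \<subseteq> B}. g B))"
    by (rule signed_sum_expand[OF fin])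
  also have "\<dots> = (\<Sum>T\<in>{W}. (-2) ^ card T * (\<Sum>B\<in>{B \<in> ?F. T \<subseteq> B}. g B))"
    using fin zero by (intro sum.mono_neutral_right) auto
  also have "\<dots> = - ((-2) ^ k)"
  proof -
    have "(\<Sum>B\<in>{B \<in> ?F. W \<subseteq> B}. g B) = -1"
      unfolding onlyW using W by (simp add: g_def)
    then show ?thesis using V(3) by simp
  qed
  finally have "(\<Sum>B\<in>?F. g B * (-1) ^ card (W \<inter> B)) = - ((-2) ^ k)" .
  moreover have "(\<Sum>B\<in>?F. g B * (-1) ^ card (W \<inter> B))
      = (\<Sum>B\<in>?F. if B \<in> Bl then real c * (-1) ^ card (W \<inter> B) else 0)
        - (\<Sum>B\<in>?F. (-1) ^ card (W \<inter> B))"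
    unfolding sum_subtractf[symmetric] by (intro sum.cong) (auto simp: g_def algebra_simps)
  moreover have "(\<Sum>B\<in>?F. if B \<in> Bl then real c * (-1) ^ card (W \<inter> B) else 0)
      = real c * (\<Sum>B\<in>Bl. (-1) ^ card (W \<inter> B))"
    using fin sub by (simp add: sum.inter_restrict[symmetric] sum_distrib_left Int_absorb1)
  ultimately show ?thesis by (simp add: c)
qed

text \<open>
  Through a \<open>(k - 2)\<close>-set \<open>T\<close> pass \<open>(k + 2) / 2\<close> blocks: the \<open>k + 2\<close> one-point extensions of \<open>T\<close>
  lie in one block each, and a block through \<open>T\<close> contains two of them.
\<close>

lemma even_block_size:
  assumes V: "finite V" "card V = 2 * k" "2 \<le> k"
    and Bl: "\<And>B. B \<in> Bl \<Longrightarrow> B \<subseteq> V \<and> card B = k"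
    and steiner: "\<And>U. U \<subseteq> V \<Longrightarrow> card U = k - 1 \<Longrightarrow> card {B \<in> Bl. U \<subseteq> B} = 1"
  shows "even k"
proof -
  have "k - 2 \<le> card V" using V by simp
  then obtain T where T: "T \<subseteq> V" "card T = k - 2"
    by (rule obtain_subset_with_card_n)
  have "card {B \<in> Bl. T \<subseteq> B} * ((k - card T) choose (k - 1 - card T))
      = 1 * ((card V - card T) choose (k - 1 - card T))"
    using T V by (intro blocks_containing_subset[OF V(1) T(1) _ Bl steiner]) auto
  moreover have "k - card T = 2" "k - 1 - card T = 1" "card V - card T = k + 2"
    using T V by auto
  ultimately have "card {B \<in> Bl. T \<subseteq> B} * 2 = k + 2" by simp
  then show ?thesis by presburger
qed

section \<open>Krawtchouk values and the Walsh transform\<close>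

lemma signed_sum_subsets_krawtchouk:
  assumes V: "finite V" "W \<subseteq> V"
  shows "(\<Sum>B\<in>{B. B \<subseteq> V \<and> card B = k}. (-1) ^ card (W \<inter> B))
           = krawtchouk (card V) k (real (card W))"
proof -
  let ?F = "{B. B \<subseteq> V \<and> card B = k}"
  have finW: "finite W" using V finite_subset by blast
  have count: "card {B \<in> ?F. card (W \<inter> B) = j}
      = (card W choose j) * ((card V - card W) choose (k - j))" if "j \<le> k" for j
  proof -
    have "bij_betw (\<lambda>B. (W \<inter> B, B - W)) {B \<in> ?F. card (W \<inter> B) = j}
        ({X. X \<subseteq> W \<and> card X = j} \<times> {Y. Y \<subseteq> V - W \<and> card Y = k - j})"
    proof (rule bij_betw_byWitness[where f' = "\<lambda>(X, Y). X \<union> Y"])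
      show "(\<lambda>B. (W \<inter> B, B - W)) ` {B \<in> ?F. card (W \<inter> B) = j}
          \<subseteq> {X. X \<subseteq> W \<and> card X = j} \<times> {Y. Y \<subseteq> V - W \<and> card Y = k - j}"
        using finW by (auto simp: card_Diff_subset_Int Int_commute)
      show "(\<lambda>(X, Y). X \<union> Y) ` ({X. X \<subseteq> W \<and> card X = j} \<times> {Y. Y \<subseteq> V - W \<and> card Y = k - j})
          \<subseteq> {B \<in> ?F. card (W \<inter> B) = j}"
      proof clarsimp
        fix X Y assume XY: "X \<subseteq> W" "Y \<subseteq> V - W" "card Y = k - card X" "j = card X"
        then have "finite X" "finite Y" "X \<inter> Y = {}" "W \<inter> (X \<union> Y) = X"
          using V finW finite_subset[of Y V] finite_subset[of X W] by auto
        then show "X \<subseteq> V \<and> Y \<subseteq> V \<and> card (X \<union> Y) = k \<and> card (W \<inter> (X \<union> Y)) = card X"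
          using XY V that by (auto simp: card_Un_disjoint)
      qed
    qed auto
    then have "card {B \<in> ?F. card (W \<inter> B) = j}
        = card ({X. X \<subseteq> W \<and> card X = j} \<times> {Y. Y \<subseteq> V - W \<and> card Y = k - j})"
      by (rule bij_betw_same_card)
    also have "\<dots> = (card W choose j) * (card (V - W) choose (k - j))"
      using V(1) finW by (simp add: card_cartesian_product n_subsets)
    finally show ?thesis using V finW by (simp add: card_Diff_subset)
  qed
  have fin: "finite ?F" using V by simp
  have img: "(\<lambda>B. card (W \<inter> B)) ` ?F \<subseteq> {0..k}"
    using V(1) by (auto intro!: card_mono dest: finite_subset)
  have "(\<Sum>B\<in>?F. (-1) ^ card (W \<inter> B) :: real)
      = (\<Sum>j=0..k. \<Sum>B\<in>{B \<in> ?F. card (W \<inter> B) = j}. (-1) ^ card (W \<inter> B))"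
    by (rule sum.group[OF fin _ img, symmetric]) simp
  also have "\<dots> = (\<Sum>j=0..k. (-1) ^ j * (real (card W) gchoose j)
      * ((real (card V) - real (card W)) gchoose (k - j)))"
  proof (intro sum.cong refl)
    fix j assume j: "j \<in> {0..k}"
    have "(\<Sum>B\<in>{B \<in> ?F. card (W \<inter> B) = j}. (-1) ^ card (W \<inter> B) :: real)
        = real (card {B \<in> ?F. card (W \<inter> B) = j}) * (-1) ^ j" by simp
    also have "\<dots> = (-1) ^ j * real (card W choose j) * real ((card V - card W) choose (k - j))"
      using j by (subst count) auto
    finally show "(\<Sum>B\<in>{B \<in> ?F. card (W \<inter> B) = j}. (-1) ^ card (W \<inter> B))
        = (-1) ^ j * (real (card W) gchoose j) * ((real (card V) - real (card W)) gchoose (k - j))"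
      using V by (simp add: binomial_gbinomial of_nat_diff card_mono)
  qed
  finally show ?thesis by (simp add: krawtchouk_def)
qed

lemma bit_sum_sign:
  fixes f :: "'a \<Rightarrow> bit"
  assumes "finite A"
  shows "(-1 :: real) ^ (of_bit (sum f A) :: nat) = (-1) ^ card {i \<in> A. f i = 1}"
  using assms
proof (induction A rule: finite_induct)
  case (insert x A)
  have step: "(-1 :: real) ^ (of_bit (b + c) :: nat) = (-1) ^ (of_bit b :: nat) * (-1) ^ (of_bit c :: nat)"
    for b c :: bit by (cases b; cases c) auto
  have "{i \<in> insert x A. f i = 1} = (if f x = 1 then insert x {i \<in> A. f i = 1} else {i \<in> A. f i = 1})"
    by auto
  then show ?case using insert by (cases "f x") (auto simp: step)
qed simp

lemma bij_betw_vec_support: "bij_betw (vec_support n) (gf2_vecs n) (Pow {1..n})"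
proof (rule bij_betw_byWitness
    [where f' = "\<lambda>S. restrict (\<lambda>i. if i \<in> S then 1 else 0) {1..n}"])
  show "\<forall>x\<in>gf2_vecs n. restrict (\<lambda>i. if i \<in> vec_support n x then 1 else 0) {1..n} = x"
    by (auto simp: gf2_vecs_def vec_support_def fun_eq_iff PiE_def extensional_def restrict_def)
qed (auto simp: gf2_vecs_def vec_support_def)

lemma walsh_design_char:
  assumes "snd D \<subseteq> Pow {1..n}"
  shows "walsh n (design_char n D) w = (\<Sum>B\<in>snd D. (-1) ^ card (vec_support n w \<inter> B))"
proof -
  have sign: "(-1 :: real) ^ (of_bit (dot_prod n w x) :: nat)
      = (-1) ^ card (vec_support n w \<inter> vec_support n x)" for x
  proof -
    have "{i \<in> {1..n}. w i * x i = 1} = vec_support n w \<inter> vec_support n x"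
      by (auto simp: vec_support_def)
    then show ?thesis unfolding dot_prod_def by (subst bit_sum_sign) auto
  qed
  have "walsh n (design_char n D) w
      = (\<Sum>x\<in>gf2_vecs n. (if vec_support n x \<in> snd D
            then (-1) ^ card (vec_support n w \<inter> vec_support n x) else 0))"
    unfolding walsh_def sign by (intro sum.cong) (auto simp: design_char_def)
  also have "\<dots> = (\<Sum>B\<in>Pow {1..n}. if B \<in> snd D then (-1) ^ card (vec_support n w \<inter> B) else 0)"
    by (rule sum.reindex_bij_betw[OF bij_betw_vec_support])
  finally show ?thesis
    using assms by (simp add: sum.inter_restrict[symmetric] Int_absorb1)
qed

section \<open>The constant \<open>a\<close> and the Walsh value\<close>

lemma alternating_binomial_partial_sum:
  "(\<Sum>l<h. (-1) ^ l * real (Suc m choose Suc l)) = 1 - (-1) ^ h * real (m choose h)"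
  by (induction h) (auto simp: algebra_simps)

text \<open>
  After the inner sum telescopes, the remaining terms \<open>(-1)^h (m choose h)^2\<close> are those of
  \<open>P\<^sub>m(m)\<close> for length \<open>2m\<close>, by the symmetry of binomial coefficients.
\<close>

lemma double_binomial_sum_krawtchouk:
  "(\<Sum>h=1..m. real (m choose h) * (\<Sum>l=0..h-1. (-1) ^ l * real (Suc m choose (l + 1))))
     = 2 ^ m - krawtchouk (2 * m) m (real m)"
proof -
  have "(\<Sum>h=1..m. real (m choose h) * (\<Sum>l=0..h-1. (-1) ^ l * real (Suc m choose (l + 1))))
      = (\<Sum>h=1..m. real (m choose h) * (1 - (-1) ^ h * real (m choose h)))"
  proof (intro sum.cong refl)
    fix h assume "h \<in> {1..m}"
    then have "{0..h-1} = {..<h}" by auto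
    then show "real (m choose h) * (\<Sum>l=0..h-1. (-1) ^ l * real (Suc m choose (l + 1)))
        = real (m choose h) * (1 - (-1) ^ h * real (m choose h))"
      using alternating_binomial_partial_sum[of m h] by (simp del: binomial_Suc_Suc)
  qed
  \<comment> \<open>The term at \<open>h = 0\<close> vanishes, so it may be added to complete the range.\<close>
  also have "\<dots> = (\<Sum>h\<le>m. real (m choose h) * (1 - (-1) ^ h * real (m choose h)))"
    by (rule sum.mono_neutral_left) (auto simp: not_le)
  also have "\<dots> = (\<Sum>h\<le>m. real (m choose h)) - (\<Sum>h\<le>m. (-1) ^ h * real (m choose h) * real (m choose h))"
    by (simp add: sum_subtractf[symmetric] algebra_simps)
  also have "(\<Sum>h\<le>m. real (m choose h)) = 2 ^ m"
    using choose_row_sum[of m] by (metis of_nat_numeral of_nat_power of_nat_sum)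
  also have "(\<Sum>h\<le>m. (-1) ^ h * real (m choose h) * real (m choose h)) = krawtchouk (2 * m) m (real m)"
    unfolding krawtchouk_def atMost_atLeast0
    by (intro sum.cong)
       (auto simp: binomial_gbinomial[symmetric] binomial_symmetric[symmetric])
  finally show ?thesis .
qed

theorem theorem35:
  fixes n :: nat and D :: block_design and w :: "nat \<Rightarrow> bit" and a :: real
  assumes "n \<ge> 4" and "even n"
    and "t_design ((n - 2) div 2) n (n div 2) 1 D"
    and "w \<in> gf2_vecs n"
    and "card (vec_support n w) = n div 2"
    and "vec_support n w \<notin> snd D"
    and "a = 2 ^ (n div 2)
             - 2 * (\<Sum>h=1..n div 2. real ((n div 2) choose h) *
                      (\<Sum>l=0..h-1. (-1) ^ l * real (((n + 2) div 2) choose (l + 1))))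
               / (real n + 2)"
  shows "walsh n (design_char n D) w = - (2 * (a - krawtchouk n (n div 2) (real n / 2)) / real n)"
proof -
  define m where "m = n div 2"
  have n: "n = 2 * m" and m: "2 \<le> m" using assms(1,2) by (auto simp: m_def)
  have nd: "n div 2 = m" "(n - 2) div 2 = m - 1" "(n + 2) div 2 = Suc m" "real n / 2 = real m"
    using n by auto
  define W where "W = vec_support n w"
  define P where "P = krawtchouk n m (real m)"
  define S where "S = walsh n (design_char n D) w"
  note design = assms(3)[unfolded t_design_def nd]
  have blocks: "B \<subseteq> {1..n} \<and> card B = m" if "B \<in> snd D" for B
    using design that by blast
  have steiner: "card {B \<in> snd D. U \<subseteq> B} = 1" if "U \<subseteq> {1..n}" "card U = m - 1" for U
    using design that by blast
  have W: "W \<subseteq> {1..n}" "card W = m" "W \<notin> snd D"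
    using assms(5,6) nd by (auto simp: W_def vec_support_def)
  have "even m"
    using even_block_size[OF _ _ m blocks steiner] n by simp
  have "S = (\<Sum>B\<in>snd D. (-1) ^ card (W \<inter> B))"
    unfolding S_def W_def using blocks by (intro walsh_design_char) auto
  moreover have "(real (card {1..n}) - real m + 1) * (\<Sum>B\<in>snd D. (-1) ^ card (W \<inter> B))
      = (\<Sum>B\<in>{B. B \<subseteq> {1..n} \<and> card B = m}. (-1) ^ card (W \<inter> B)) - (-2) ^ m"
    using m by (intro steiner_signed_sum[OF _ W(1,2) _ blocks steiner W(3)]) auto
  moreover have "(\<Sum>B\<in>{B. B \<subseteq> {1..n} \<and> card B = m}. (-1) ^ card (W \<inter> B)) = P"
    using signed_sum_subsets_krawtchouk[OF _ W(1), of m] W(2) by (simp add: P_def)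
  ultimately have S: "(real m + 1) * S = P - 2 ^ m"
    using n \<open>even m\<close> by simp
  have "a = 2 ^ m - 2 * (2 ^ m - P) / (real n + 2)"
    using assms(7)[unfolded nd double_binomial_sum_krawtchouk] by (simp only: P_def n)
  then have "a - P = real m * (2 ^ m - P) / (real m + 1)"
    using n by (simp add: field_simps)
  then have "- (2 * (a - P) / real n) = (P - 2 ^ m) / (real m + 1)"
    using n m by (simp add: field_simps)
  also have "\<dots> = S" using S by (simp add: field_simps)
  finally show ?thesis unfolding nd P_def S_def by simp
qed

end
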